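(* Let $\widehat r_2,\widehat r_3,\widehat r_\infty^-\in\{0,1,2,\ldots\}\cup\{\infty\}$ and $\widehat r_\infty^+\in\{0,2,4,\ldots\}\cup\{\infty\}$ satisfy 1. $\widehat r_2+\widehat r_3+\widehat r_\infty^-+\widehat r_\infty^+=\infty$; 2. $\widehat r_\infty^-\geq 1$; 3. $\widehat r_2+\widehat r_3+\frac{\widehat r_\infty^+}{2}\geq \widehat r_\infty^-$. Then there is a Neumann subgroup $\widehat S$ of $\widehat M$ such that $\widehat S\setminus M\neq\emptyset$ and $\widehat S$ has $(\widehat r_2,\widehat r_3,\widehat r_\infty^-+\widehat r_\infty^+)$-structure, where $\widehat r_\infty^{-}$ (respectively $\widehat r_\infty^{+}$) is the number of the free generators (the generators of the infinite cyclic factors) having determinant $-1$ (respectively $+1$).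
   Context: Let $\widehat M$ be the extended modular group, i.e. the group of all maps $z\mapsto \frac{az+b}{cz+d}$ with $a,b,c,d\in\mathbb Z$, $ad-bc=\pm1$, acting on $\overline{\mathbb Q}=\mathbb Q\cup\{\infty\}$ (with the usual conventions for $\infty$); it is identified with $PGL(2,\mathbb Z)=GL(2,\mathbb Z)/\{\pm I\}$. The determinant of an element is $ad-bc\in\{\pm1\}$ (well defined), and the modular group $M\subset\widehat M$ is the normal subgroup of elements with determinant $1$. A subgroup $\widehat S\subset\widehat M$ is a Neumann subgroup of $\widehat M$ if for every $r\in\overline{\mathbb Q}$ there exists exactly one $\alpha\in\widehat S$ with $\alpha(\infty)=r$. A group has $(r_2,r_3,r_\infty)$-structure if it is a free product of $r_2$ subgroups of order $2$, $r_3$ subgroups of order $3$ and $r_\infty$ infinite cyclic subgroups. Here $\infty$ means countably infinite, with the usual conventions for sums, $\infty/2=\infty$ and $\infty\ge\infty$. *)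

theory Defs
  imports "HOL-Algebra.Generated_Groups" "HOL-Library.Extended_Nat"
begin

section \<open>The extended modular group\<close>

text \<open>The extended rationals; \<open>None\<close> is the point at infinity.\<close>

type_synonym qbar = "rat option"

abbreviation qinf :: qbar where
  "qinf \<equiv> None"

text \<open>
  The action of \<open>z \<mapsto> (a z + b) / (c z + d)\<close>.  It is only used for \<open>a d - b c = \<plusminus>1\<close>, so numerator
  and denominator never vanish simultaneously.
\<close>

definition moebius :: "int \<Rightarrow> int \<Rightarrow> int \<Rightarrow> int \<Rightarrow> qbar \<Rightarrow> qbar" where
  "moebius a b c d z =
     (case z of
        None \<Rightarrow> if c = 0 then qinf else Some (of_int a / of_int c)
      | Some q \<Rightarrow>
          if of_int c * q + of_int d = 0 then qinf
          else Some ((of_int a * q + of_int b) / (of_int c * q + of_int d)))"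

definition ext_modular_maps :: "(qbar \<Rightarrow> qbar) set" where
  "ext_modular_maps = {moebius a b c d | a b c d. a * d - b * c \<in> {1, -1}}"

definition ext_modular_group :: "(qbar \<Rightarrow> qbar) monoid" where
  "ext_modular_group = \<lparr>carrier = ext_modular_maps, mult = (\<circ>), one = id\<rparr>"

text \<open>The determinant of a map; independence of the matrix is \<open>mdet_moebius\<close> below.\<close>

definition mdet :: "(qbar \<Rightarrow> qbar) \<Rightarrow> int" where
  "mdet \<alpha> = (THE \<delta>. \<exists>a b c d. \<alpha> = moebius a b c d \<and> \<delta> = a * d - b * c \<and> \<delta> \<in> {1, -1})"

definition modular_maps :: "(qbar \<Rightarrow> qbar) set" where
  "modular_maps = {\<alpha> \<in> ext_modular_maps. mdet \<alpha> = 1}"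

definition neumann_subgroup :: "(qbar \<Rightarrow> qbar) set \<Rightarrow> bool" where
  "neumann_subgroup S \<longleftrightarrow>
     subgroup S ext_modular_group \<and> (\<forall>r. \<exists>!\<alpha>. \<alpha> \<in> S \<and> \<alpha> qinf = r)"

lemma unimodular_no_common_zero:
  assumes "a * d - b * c \<in> {1, -1 :: int}"
  shows "\<not> (of_int c * q + of_int d = 0 \<and> of_int a * q + of_int b = (0 :: rat))"
proof
  assume *: "of_int c * q + of_int d = 0 \<and> of_int a * q + of_int b = (0 :: rat)"
  have c: "of_int d = - (of_int c * q)" and a: "of_int b = - (of_int a * q)"
    using * by (auto simp: eq_neg_iff_add_eq_0 add.commute)
  have "of_int (a * d - b * c) = (0 :: rat)"
    by (simp add: a c)
  then show False using assms by (simp only: of_int_eq_0_iff) auto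
qed

lemma moebius_comp:
  assumes "a * d - b * c \<in> {1, -1}" and "a' * d' - b' * c' \<in> {1, -1}"
  shows "moebius a b c d \<circ> moebius a' b' c' d' =
    moebius (a * a' + b * c') (a * b' + b * d') (c * a' + d * c') (c * b' + d * d')"
proof
  fix z
  show "(moebius a b c d \<circ> moebius a' b' c' d') z =
    moebius (a * a' + b * c') (a * b' + b * d') (c * a' + d * c') (c * b' + d * d') z"
  proof (cases z)
    case None
    show ?thesis
    proof (cases "c' = 0")
      case True
      then have "a' \<noteq> 0" using assms(2) by auto
      then show ?thesis using True None by (auto simp: moebius_def)
    next
      case False
      define C where "C = (of_int c' :: rat)"
      have C: "C \<noteq> 0" using False by (simp add: C_def)
      have e: "of_int c * (of_int a' / C) + of_int d = (of_int (c * a' + d * c') :: rat) / C"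
        using C by (simp add: C_def field_simps)
      have f: "of_int a * (of_int a' / C) + of_int b = (of_int (a * a' + b * c') :: rat) / C"
        using C by (simp add: C_def field_simps)
      show ?thesis
        using None False C
        by (simp only: moebius_def o_def option.case if_False C_def[symmetric] e f
              divide_eq_0_iff of_int_eq_0_iff) simp
    qed
  next
    case (Some q)
    define N where "N = of_int a' * q + of_int b'"
    define D where "D = of_int c' * q + of_int d'"
    have ND: "\<not> (D = 0 \<and> N = 0)"
      using unimodular_no_common_zero[OF assms(2)] by (simp add: N_def D_def)
    have e: "of_int (c * a' + d * c') * q + of_int (c * b' + d * d') = of_int c * N + of_int d * D"
      by (simp add: N_def D_def algebra_simps)
    have f: "of_int (a * a' + b * c') * q + of_int (a * b' + b * d') = of_int a * N + of_int b * D"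
      by (simp add: N_def D_def algebra_simps)
    have R: "moebius (a * a' + b * c') (a * b' + b * d') (c * a' + d * c') (c * b' + d * d') z =
       (if of_int c * N + of_int d * D = 0 then qinf
        else Some ((of_int a * N + of_int b * D) / (of_int c * N + of_int d * D)))"
      using Some by (simp only: moebius_def option.case e f)
    have L: "moebius a' b' c' d' z = (if D = 0 then qinf else Some (N / D))"
      using Some by (simp add: moebius_def N_def D_def)
    show ?thesis
    proof (cases "D = 0")
      case True
      then show ?thesis using ND by (simp add: R L) (simp add: moebius_def)
    next
      case False
      have e': "of_int c * (N / D) + of_int d = (of_int c * N + of_int d * D) / D"
        and f': "of_int a * (N / D) + of_int b = (of_int a * N + of_int b * D) / D"
        using False by (simp_all add: field_simps)
      have "moebius a b c d (Some (N / D)) =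
         (if of_int c * N + of_int d * D = 0 then qinf
          else Some ((of_int a * N + of_int b * D) / (of_int c * N + of_int d * D)))"
        using False by (simp only: moebius_def option.case e' f' divide_eq_0_iff) simp
      then show ?thesis using False by (simp add: R L)
    qed
  qed
qed

lemma moebius_id: "moebius 1 0 0 1 = id"
  by (rule ext) (auto simp: moebius_def split: option.split)

lemma moebius_eq_id:
  assumes "moebius a b c d = id" and "a * d - b * c \<in> {1, -1}"
  shows "b = 0" "c = 0" "a = d"
proof -
  have i: "moebius a b c d None = None" and z: "moebius a b c d (Some 0) = Some 0"
    and o: "moebius a b c d (Some 1) = Some 1"
    using assms(1) by simp_all
  show c: "c = 0" using i by (auto simp: moebius_def split: if_splits)
  show b: "b = 0" using z by (auto simp: moebius_def split: if_splits)
  show "a = d" using o by (auto simp: moebius_def b c split: if_splits)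
qed

lemma moebius_left_inverse:
  assumes "a * d - b * c \<in> {1, -1}"
  shows "moebius d (- b) (- c) a \<circ> moebius a b c d = id"
proof -
  define e where "e = a * d - b * c"
  have e: "e \<in> {1, -1}" using assms by (simp add: e_def)
  have "d * a - (- b) * (- c) \<in> {1, -1}" using assms by (simp add: algebra_simps)
  from moebius_comp[OF this assms]
  have "moebius d (- b) (- c) a \<circ> moebius a b c d = moebius e 0 0 e"
    by (simp add: e_def algebra_simps)
  also have "\<dots> = id"
    using e by (intro ext) (auto simp: moebius_def split: option.split)
  finally show ?thesis .
qed

lemma moebius_det_unique:
  assumes "a * d - b * c \<in> {1, -1}" "a' * d' - b' * c' \<in> {1, -1}"
    and eq: "moebius a b c d = moebius a' b' c' d'"
  shows "a * d - b * c = a' * d' - b' * c'"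
proof -
  define p q r s where "p = d * a' + (- b) * c'" and "q = d * b' + (- b) * d'"
    and "r = (- c) * a' + a * c'" and "s = (- c) * b' + a * d'"
  have inv: "d * a - (- b) * (- c) \<in> {1, -1}" using assms(1) by (simp add: algebra_simps)
  have id: "moebius p q r s = id"
    using moebius_comp[OF inv assms(2)] moebius_left_inverse[OF assms(1)] eq
    by (simp add: p_def q_def r_def s_def)
  have m: "p * s - q * r = (a * d - b * c) * (a' * d' - b' * c')"
    by (simp add: p_def q_def r_def s_def algebra_simps)
  have "p * s - q * r \<in> {1, -1}" unfolding m using assms(1,2) by auto
  moreover from moebius_eq_id[OF id this] have "p * s - q * r = p * p" by simp
  ultimately have "p * s - q * r = 1"
    by (metis insertE singletonD not_one_le_zero zero_le_square neg_0_le_iff_le)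
  then show ?thesis unfolding m using assms(1,2) by auto
qed

lemma mdet_moebius:
  assumes "a * d - b * c \<in> {1, -1}"
  shows "mdet (moebius a b c d) = a * d - b * c"
  unfolding mdet_def
proof (rule the_equality)
  show "\<exists>a' b' c' d'. moebius a b c d = moebius a' b' c' d' \<and>
      a * d - b * c = a' * d' - b' * c' \<and> a * d - b * c \<in> {1, -1}"
    using assms by blast
next
  fix \<delta>
  assume "\<exists>a' b' c' d'. moebius a b c d = moebius a' b' c' d' \<and>
      \<delta> = a' * d' - b' * c' \<and> \<delta> \<in> {1, -1}"
  then show "\<delta> = a * d - b * c"
    using moebius_det_unique[OF assms] by metis
qed

lemma group_ext_modular_group: "group ext_modular_group"
proof (rule groupI)
  fix x y
  assume "x \<in> carrier ext_modular_group" "y \<in> carrier ext_modular_group"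
  then obtain a b c d a' b' c' d'
    where x: "x = moebius a b c d" "a * d - b * c \<in> {1, -1}"
      and y: "y = moebius a' b' c' d'" "a' * d' - b' * c' \<in> {1, -1}"
    unfolding ext_modular_group_def ext_modular_maps_def by auto
  have m: "(a * a' + b * c') * (c * b' + d * d') - (a * b' + b * d') * (c * a' + d * c') =
      (a * d - b * c) * (a' * d' - b' * c')"
    by (simp add: algebra_simps)
  have "(a * a' + b * c') * (c * b' + d * d') - (a * b' + b * d') * (c * a' + d * c') \<in> {1, -1}"
    unfolding m using x(2) y(2) by auto
  then show "x \<otimes>\<^bsub>ext_modular_group\<^esub> y \<in> carrier ext_modular_group"
    using moebius_comp[OF x(2) y(2)] x(1) y(1)
    unfolding ext_modular_group_def ext_modular_maps_def by simp blast
next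
  show "\<one>\<^bsub>ext_modular_group\<^esub> \<in> carrier ext_modular_group"
    unfolding ext_modular_group_def ext_modular_maps_def
    using moebius_id by (simp, intro exI[of _ 1] exI[of _ 0]) simp
next
  fix x
  assume "x \<in> carrier ext_modular_group"
  then obtain a b c d where x: "x = moebius a b c d" "a * d - b * c \<in> {1, -1}"
    unfolding ext_modular_group_def ext_modular_maps_def by auto
  have "d * a - (- b) * (- c) \<in> {1, -1}" using x(2) by (simp add: algebra_simps)
  then have "moebius d (- b) (- c) a \<in> carrier ext_modular_group"
    unfolding ext_modular_group_def ext_modular_maps_def by (simp, blast)
  then show "\<exists>y\<in>carrier ext_modular_group.
      y \<otimes>\<^bsub>ext_modular_group\<^esub> x = \<one>\<^bsub>ext_modular_group\<^esub>"
    using moebius_left_inverse[OF x(2)] x(1) unfolding ext_modular_group_def by auto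
qed (auto simp: ext_modular_group_def)

section \<open>Free products of subgroups\<close>

text \<open>
  \<open>G\<close> is the (internal) free product of the family \<open>(H i)\<close>, \<open>i \<in> I\<close>, of subgroups: the \<open>H i\<close>
  generate \<open>G\<close>, and no nonempty reduced word, that is, no product of non-identity elements of the
  factors with neighbouring letters taken from factors of different index, is the identity.
\<close>

definition reduced_word :: "('a, 'm) monoid_scheme \<Rightarrow> 'i set \<Rightarrow> ('i \<Rightarrow> 'a set) \<Rightarrow> ('i \<times> 'a) list \<Rightarrow> bool"
  where "reduced_word G I H w \<longleftrightarrow>
    (\<forall>(i, x) \<in> set w. i \<in> I \<and> x \<in> H i \<and> x \<noteq> \<one>\<^bsub>G\<^esub>) \<and>
    successively (\<lambda>u v. fst u \<noteq> fst v) w"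

definition word_product :: "('a, 'm) monoid_scheme \<Rightarrow> ('i \<times> 'a) list \<Rightarrow> 'a" where
  "word_product G w = foldr (\<lambda>(i, x) y. x \<otimes>\<^bsub>G\<^esub> y) w \<one>\<^bsub>G\<^esub>"

definition is_free_product :: "('a, 'm) monoid_scheme \<Rightarrow> 'i set \<Rightarrow> ('i \<Rightarrow> 'a set) \<Rightarrow> bool" where
  "is_free_product G I H \<longleftrightarrow>
     group G \<and> (\<forall>i\<in>I. subgroup (H i) G) \<and>
     generate G (\<Union>i\<in>I. H i) = carrier G \<and>
     (\<forall>w. reduced_word G I H w \<and> w \<noteq> [] \<longrightarrow> word_product G w \<noteq> \<one>\<^bsub>G\<^esub>)"

text \<open>
  \<open>r\<close> factors of a given kind are numbered by \<open>{n. enat n < r}\<close>; for \<open>r = \<infinity>\<close> this is all of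
  \<open>nat\<close>, that is, there are countably infinitely many of them.
\<close>

datatype factor = Ord2 nat | Ord3 nat | InfCyc nat

definition factors :: "enat \<Rightarrow> enat \<Rightarrow> enat \<Rightarrow> factor set" where
  "factors r2 r3 ri =
     Ord2 ` {n. enat n < r2} \<union> Ord3 ` {n. enat n < r3} \<union> InfCyc ` {n. enat n < ri}"

text \<open>
  \<open>H\<close> exhibits \<open>G\<close> as a free product of \<open>r2\<close> subgroups of order 2, \<open>r3\<close> subgroups of order 3 and
  \<open>ri\<close> infinite cyclic subgroups, the latter with the chosen (free) generators \<open>t n\<close>.
\<close>

definition structure_decomposition ::
  "('a, 'm) monoid_scheme \<Rightarrow> enat \<Rightarrow> enat \<Rightarrow> enat \<Rightarrow> (factor \<Rightarrow> 'a set) \<Rightarrow> (nat \<Rightarrow> 'a) \<Rightarrow> bool" where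
  "structure_decomposition G r2 r3 ri H t \<longleftrightarrow>
     is_free_product G (factors r2 r3 ri) H \<and>
     (\<forall>n. enat n < r2 \<longrightarrow> card (H (Ord2 n)) = 2) \<and>
     (\<forall>n. enat n < r3 \<longrightarrow> card (H (Ord3 n)) = 3) \<and>
     (\<forall>n. enat n < ri \<longrightarrow>
        t n \<in> carrier G \<and> H (InfCyc n) = generate G {t n} \<and> infinite (H (InfCyc n)))"

section \<open>Extended natural numbers\<close>

text \<open>Only applied to countable sets, so \<open>\<infinity>\<close> means countably infinite.\<close>

definition ecard :: "'a set \<Rightarrow> enat" where
  "ecard A = (if finite A then enat (card A) else \<infinity>)"

text \<open>Only applied to \<open>\<infinity>\<close> and to even numbers.\<close>

definition ehalf :: "enat \<Rightarrow> enat" where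
  "ehalf r = (case r of enat n \<Rightarrow> enat (n div 2) | \<infinity> \<Rightarrow> \<infinity>)"

end

theory Submission
  imports Defs "HOL-Library.Countable_Set"
begin

text \<open>
  The Neumann subgroup is generated by one element for each of the required factors, and both its
  free product structure and its simply transitive action come from ping-pong on the extended
  rationals. Three elements are the building blocks: \<open>-1/z\<close> of order 2, \<open>-1/(z+1)\<close> of order 3, and
  \<open>-(z+1)/(z+2)\<close>, a glide reflection of determinant \<open>-1\<close> whose two fixed points are irrational.
  For each of them, every nontrivial power moves \<open>(0,\<infinity>]\<close> into the ray \<open>(-\<infinity>,0]\<close>. The rationals are
  the disjoint union of \<open>(-\<infinity>,0]\<close> and the intervals \<open>(i,i+1]\<close>, \<open>i \<ge> 0\<close>, and each of these intervals
  is the image of the ray under a modular map. So one building block can be conjugated into each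
  piece, in any order. The only point outside all the pieces is \<open>\<infinity>\<close>; a nonempty reduced word moves
  \<open>\<infinity>\<close> into the piece of its first letter (\<open>ping_pong_word\<close>), hence is not the identity, and no
  element of the group other than the identity fixes \<open>\<infinity>\<close>.

  For transitivity it suffices to reach the integers (\<open>transitive_if_integers\<close>): an element sending
  \<open>\<infinity>\<close> to the integer part of a fraction \<open>p/q\<close> has an inverse that sends \<open>p/q\<close> to a fraction with
  denominator \<open>p mod q\<close>. The nonnegative integers are reached from left to right, as the block in
  \<open>(i,i+1]\<close> relates its two ends. For the others a block acts, in the coordinate of the ray, like
  \<open>-1/(z+c)\<close> with \<open>c \<in> {0,1,3}\<close>, which carries \<open>-n\<close> to \<open>1/(n-c)\<close>; from there the blocks of the
  successive intervals lead to a nonnegative integer or to \<open>\<infinity>\<close> (\<open>integers_in_orbit\<close>).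

  So far all generators of infinite order are glide reflections, of determinant \<open>-1\<close>. One of them,
  \<open>s\<^sub>0\<close>, is kept, and wherever determinant \<open>1\<close> is wanted a generator \<open>s\<^sub>n\<close> is replaced by \<open>s\<^sub>0 s\<^sub>n\<close>. The
  group is unchanged, and cutting and pasting the ping-pong domains (\<open>ping_pong_twist\<close>) shows that
  it is still the free product with the new generators.
\<close>

section \<open>The group of extended modular maps\<close>

abbreviation E :: "(qbar \<Rightarrow> qbar) monoid" where
  "E \<equiv> ext_modular_group"

interpretation E: group E
  by (rule group_ext_modular_group)

lemma E_mult [simp]: "x \<otimes>\<^bsub>E\<^esub> y = x \<circ> y"
  and E_one [simp]: "\<one>\<^bsub>E\<^esub> = id"
  by (simp_all add: ext_modular_group_def)

lemma moebius_in_E: "a * d - b * c \<in> {1, -1} \<Longrightarrow> moebius a b c d \<in> carrier E"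
  by (auto simp: ext_modular_group_def ext_modular_maps_def)

lemma E_moebiusE:
  assumes "x \<in> carrier E"
  obtains a b c d where "x = moebius a b c d" "a * d - b * c \<in> {1, -1}"
  using assms by (auto simp: ext_modular_group_def ext_modular_maps_def)

lemma inv_E_apply [simp]:
  assumes "x \<in> carrier E"
  shows "(inv\<^bsub>E\<^esub> x) (x z) = z" "x ((inv\<^bsub>E\<^esub> x) z) = z"
proof -
  show "(inv\<^bsub>E\<^esub> x) (x z) = z"
    using E.l_inv[OF assms] by (simp add: fun_eq_iff)
  show "x ((inv\<^bsub>E\<^esub> x) z) = z"
    using E.r_inv[OF assms] by (simp add: fun_eq_iff)
qed

lemma comp_in_E [simp]: "x \<in> carrier E \<Longrightarrow> y \<in> carrier E \<Longrightarrow> x \<circ> y \<in> carrier E"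
  using E.m_closed[of x y] by simp

lemma id_in_E [simp]: "id \<in> carrier E"
  using E.one_closed by simp

lemma inj_E: "x \<in> carrier E \<Longrightarrow> inj x"
  by (metis injI inv_E_apply(1))

lemma mdet_comp:
  assumes "x \<in> carrier E" "y \<in> carrier E"
  shows "mdet (x \<circ> y) = mdet x * mdet y"
proof -
  obtain a b c d where x: "x = moebius a b c d" "a * d - b * c \<in> {1, -1}"
    using assms(1) by (rule E_moebiusE)
  obtain a' b' c' d' where y: "y = moebius a' b' c' d'" "a' * d' - b' * c' \<in> {1, -1}"
    using assms(2) by (rule E_moebiusE)
  have m: "(a * a' + b * c') * (c * b' + d * d') - (a * b' + b * d') * (c * a' + d * c') =
      (a * d - b * c) * (a' * d' - b' * c')"
    by (simp add: algebra_simps)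
  have "(a * a' + b * c') * (c * b' + d * d') - (a * b' + b * d') * (c * a' + d * c') \<in> {1, -1}"
    unfolding m using x(2) y(2) by auto
  from mdet_moebius[OF this] show ?thesis
    unfolding x(1) y(1) moebius_comp[OF x(2) y(2)] m
    using mdet_moebius[OF x(2)] mdet_moebius[OF y(2)] by simp
qed

lemma mdet_id: "mdet id = 1"
  using mdet_moebius[of 1 1 0 0] by (simp add: moebius_id)

section \<open>Cyclic subgroups\<close>

lemma (in group) generate_involution:
  assumes "x \<in> carrier G" "x \<otimes> x = \<one>"
  shows "generate G {x} = {\<one>, x}"
proof -
  have i: "inv x = x" using assms by (simp add: inv_equality)
  have "h \<in> {\<one>, x}" if "h \<in> generate G {x}" for h
    using that by (induction rule: generate.induct) (use assms i in auto)
  then show ?thesis using generate.one[of G "{x}"] generate.incl[of x "{x}" G] by blast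
qed

lemma (in group) generate_order_three:
  assumes x: "x \<in> carrier G" and x3: "x \<otimes> (x \<otimes> x) = \<one>"
  shows "generate G {x} = {\<one>, x, x \<otimes> x}"
proof -
  have x3': "x \<otimes> x \<otimes> x = \<one>" using assms by (simp add: m_assoc)
  have i: "inv x = x \<otimes> x" using assms x3' by (simp add: inv_equality)
  have x4: "x \<otimes> x \<otimes> (x \<otimes> x) = x" using assms by (simp add: m_assoc)
  have "h \<in> {\<one>, x, x \<otimes> x}" if "h \<in> generate G {x}" for h
    using that by (induction rule: generate.induct) (use x x3 x3' i x4 in auto)
  moreover have "x \<otimes> x \<in> generate G {x}"
    by (simp add: generate.eng generate.incl)
  ultimately show ?thesis using generate.one generate.incl[of x "{x}"] by blast
qed

text \<open>
  The geometry of an element \<open>t\<close> of infinite order: \<open>A\<close> is a neighbourhood of its attracting and \<open>B\<close>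
  of its repelling fixed point. Positive powers of \<open>t\<close> send everything outside \<open>B\<close> into \<open>A\<close>.
\<close>

lemma pow_attract:
  assumes t: "t \<in> carrier E" and A: "t ` (- B) \<subseteq> A" and AB: "A \<inter> B = {}" and x: "x \<notin> B"
  shows "(t [^]\<^bsub>E\<^esub> Suc n) x \<in> A"
proof (induction n)
  case 0
  then show ?case using t A x by auto
next
  case (Suc n)
  have "t ((t [^]\<^bsub>E\<^esub> Suc n) x) \<in> A" using Suc A AB by blast
  then show ?case using E.nat_pow_Suc2[OF t, of "Suc n"] by simp
qed

text \<open>
  As \<open>t\<close> is bijective, its inverse sends everything outside \<open>A\<close> into \<open>B\<close>; this settles the negative
  powers.
\<close>

lemma generate_attract:
  assumes t: "t \<in> carrier E" and A: "t ` (- B) \<subseteq> A" and AB: "A \<inter> B = {}"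
    and h: "h \<in> generate E {t}" "h \<noteq> id" and x: "x \<notin> A \<union> B"
  shows "h x \<in> A \<union> B"
proof -
  obtain k :: int where k: "h = t [^]\<^bsub>E\<^esub> k" using h(1) E.generate_pow[OF t] by auto
  consider "k = 0" | n where "k = int (Suc n)" | n where "k = - int (Suc n)"
    by (metis int_cases3 gr0_implies_Suc)
  then show ?thesis
  proof cases
    case 1
    then show ?thesis using h(2) k by simp
  next
    case (2 n)
    then show ?thesis using pow_attract[OF t A AB, of x n] x k
      by (simp add: int_pow_int del: of_nat_Suc E.nat_pow_Suc)
  next
    case (3 n)
    define u where "u = t [^]\<^bsub>E\<^esub> Suc n"
    have u: "u \<in> carrier E" using t by (simp add: u_def del: E.nat_pow_Suc)
    have hu: "h = inv\<^bsub>E\<^esub> u"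
      unfolding k 3 u_def E.int_pow_neg[OF t] by (simp add: int_pow_int del: of_nat_Suc E.nat_pow_Suc)
    have "h x \<in> B"
    proof (rule ccontr)
      assume "h x \<notin> B"
      then have "u (h x) \<in> A" unfolding u_def by (rule pow_attract[OF t A AB])
      then show False using x hu u by simp
    qed
    then show ?thesis by simp
  qed
qed

lemma infinite_generate_attract:
  assumes t: "t \<in> carrier E" and A: "t ` (- B) \<subseteq> A" and AB: "A \<inter> B = {}" and p: "p \<notin> A \<union> B"
  shows "infinite (generate E {t})"
proof -
  have ne: "t [^]\<^bsub>E\<^esub> n \<noteq> id" if "n \<noteq> 0" for n :: nat
    using pow_attract[OF t A AB, of p "n - 1"] that p by (auto simp del: E.nat_pow_Suc)
  have "inj (\<lambda>n::nat. t [^]\<^bsub>E\<^esub> n)"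
  proof (rule linorder_injI)
    fix m n :: nat
    assume "m < n"
    have "t [^]\<^bsub>E\<^esub> (n - m) = id" if eq: "t [^]\<^bsub>E\<^esub> m = t [^]\<^bsub>E\<^esub> n"
    proof -
      have "t [^]\<^bsub>E\<^esub> (n - m) \<otimes>\<^bsub>E\<^esub> t [^]\<^bsub>E\<^esub> m = \<one>\<^bsub>E\<^esub> \<otimes>\<^bsub>E\<^esub> t [^]\<^bsub>E\<^esub> m"
        using E.nat_pow_mult[OF t, of "n - m" m] \<open>m < n\<close> eq by simp
      then have "t [^]\<^bsub>E\<^esub> (n - m) = \<one>\<^bsub>E\<^esub>"
        by (rule E.right_cancel[THEN iffD1, rotated 3]) (use t in simp_all)
      then show ?thesis by simp
    qed
    then show "t [^]\<^bsub>E\<^esub> m \<noteq> t [^]\<^bsub>E\<^esub> n" using ne[of "n - m"] \<open>m < n\<close> by auto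
  qed
  then have "infinite (range (\<lambda>n::nat. t [^]\<^bsub>E\<^esub> n))" by (simp add: range_inj_infinite)
  moreover have "range (\<lambda>n::nat. t [^]\<^bsub>E\<^esub> n) \<subseteq> generate E {t}"
    unfolding E.generate_pow[OF t] by (auto simp flip: int_pow_int)
  ultimately show ?thesis using finite_subset by blast
qed

section \<open>Ping-pong\<close>

definition ping_pong :: "'i set \<Rightarrow> ('i \<Rightarrow> (qbar \<Rightarrow> qbar) set) \<Rightarrow> ('i \<Rightarrow> qbar set) \<Rightarrow> qbar \<Rightarrow> bool" where
  "ping_pong I H X p \<longleftrightarrow>
     (\<forall>i\<in>I. p \<notin> X i) \<and> (\<forall>i\<in>I. \<forall>j\<in>I. i \<noteq> j \<longrightarrow> X i \<inter> X j = {}) \<and>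
     (\<forall>i\<in>I. \<forall>h\<in>H i. h \<noteq> id \<longrightarrow> (\<forall>x. x \<notin> X i \<longrightarrow> h x \<in> X i))"

lemma reduced_word_hd:
  assumes "reduced_word E I H w" "w \<noteq> []"
  shows "fst (hd w) \<in> I"
  using assms by (cases w) (auto simp: reduced_word_def)

text \<open>
  By induction from the right end of the word: each letter finds the current point outside its own
  domain, either because it is still \<open>p\<close> or because it lies in the domain of a neighbouring letter.
\<close>

lemma ping_pong_word:
  assumes pp: "ping_pong I H X p" and "reduced_word E I H w" "w \<noteq> []"
  shows "word_product E w p \<in> X (fst (hd w))"
  using assms(2,3)
proof (induction w)
  case (Cons v w)
  obtain i h where v: "v = (i, h)" by (cases v)
  have i: "i \<in> I" "h \<in> H i" "h \<noteq> id" and w: "reduced_word E I H w"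
    using Cons.prems(1) v by (auto simp: reduced_word_def successively_Cons)
  have "word_product E w p \<notin> X i"
  proof (cases "w = []")
    case True
    then show ?thesis using pp i by (auto simp: word_product_def ping_pong_def)
  next
    case False
    have "fst (hd w) \<noteq> i" "fst (hd w) \<in> I"
      using Cons.prems(1) v False reduced_word_hd[OF w False]
      by (auto simp: reduced_word_def successively_Cons)
    then show ?thesis using Cons.IH[OF w False] pp i unfolding ping_pong_def by blast
  qed
  then have "h (word_product E w p) \<in> X i" using pp i by (auto simp: ping_pong_def)
  then show ?case using v by (simp add: word_product_def)
qed simp

text \<open>
  The reduced words represent a set closed under left multiplication by the factors, which is what
  makes them represent the whole generated group.
\<close>

lemma reduced_word_lmult:
  assumes H: "subgroup (H i) E" and i: "i \<in> I" and h: "h \<in> H i" and w: "reduced_word E I H w"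
  shows "\<exists>w'. reduced_word E I H w' \<and> word_product E w' = h \<circ> word_product E w"
proof -
  consider "h = id" | "h \<noteq> id" "w = [] \<or> fst (hd w) \<noteq> i"
    | y w1 where "w = (i, y) # w1" "h \<circ> y = id" | y w1 where "w = (i, y) # w1" "h \<circ> y \<noteq> id"
    by (cases w) (metis, metis fst_conv list.sel(1) surj_pair)
  then show ?thesis
  proof cases
    case 1
    then show ?thesis using w by auto
  next
    case 2
    then have "reduced_word E I H ((i, h) # w)"
      using w i h by (auto simp: reduced_word_def successively_Cons)
    then show ?thesis by (intro exI[of _ "(i, h) # w"]) (simp add: word_product_def)
  next
    case (3 y w1)
    then have "reduced_word E I H w1" using w by (auto simp: reduced_word_def successively_Cons)
    then show ?thesis using 3 by (intro exI[of _ w1]) (simp add: word_product_def flip: comp_assoc)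
  next
    case (4 y w1)
    have "h \<circ> y \<in> H i"
      using subgroup.m_closed[OF H h, of y] w 4 by (auto simp: reduced_word_def)
    then have "reduced_word E I H ((i, h \<circ> y) # w1)"
      using w 4 by (auto simp: reduced_word_def successively_Cons)
    then show ?thesis using 4
      by (intro exI[of _ "(i, h \<circ> y) # w1"]) (simp add: word_product_def comp_assoc)
  qed
qed

lemma generate_reduced_word:
  assumes H: "\<And>i. i \<in> I \<Longrightarrow> subgroup (H i) E" and x: "x \<in> generate E (\<Union>i\<in>I. H i)"
  shows "\<exists>w. reduced_word E I H w \<and> x = word_product E w"
proof -
  have "\<exists>w'. reduced_word E I H w' \<and> word_product E w' = x \<circ> word_product E w"
    if "reduced_word E I H w" for w
    using x that
  proof (induction arbitrary: w rule: generate.induct)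
    case one
    then show ?case by auto
  next
    case (incl h)
    then obtain i where i: "i \<in> I" "h \<in> H i" by blast
    show ?case by (rule reduced_word_lmult[OF H[OF i(1)] i incl.prems])
  next
    case (inv h)
    then obtain i where i: "i \<in> I" "h \<in> H i" by blast
    show ?case
      by (rule reduced_word_lmult[OF H[OF i(1)] i(1) subgroup.m_inv_closed[OF H[OF i(1)] i(2)] inv.prems])
  next
    case (eng h1 h2)
    obtain w2 where w2: "reduced_word E I H w2" "word_product E w2 = h2 \<circ> word_product E w"
      using eng.IH(2)[OF eng.prems] by blast
    obtain w1 where w1: "reduced_word E I H w1" "word_product E w1 = h1 \<circ> word_product E w2"
      using eng.IH(1)[OF w2(1)] by blast
    show ?case using w1 w2 by (intro exI[of _ w1]) (simp add: comp_assoc)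
  qed
  \<comment> \<open>The statement for arbitrary \<open>w\<close> is what the product case of the induction needs.\<close>
  from this[of "[]"] show ?thesis by (auto simp: reduced_word_def word_product_def)
qed

lemma ping_pong_free:
  assumes pp: "ping_pong I H X p" and H: "\<And>i. i \<in> I \<Longrightarrow> subgroup (H i) E"
    and x: "x \<in> generate E (\<Union>i\<in>I. H i)" "x p = p"
  shows "x = id"
proof -
  obtain w where w: "reduced_word E I H w" "x = word_product E w"
    using generate_reduced_word[OF H x(1)] by blast
  have "w = []"
  proof (rule ccontr)
    assume "w \<noteq> []"
    from ping_pong_word[OF pp w(1) this] have "p \<in> X (fst (hd w))" using w x by simp
    moreover have "fst (hd w) \<in> I" by (rule reduced_word_hd[OF w(1) \<open>w \<noteq> []\<close>])
    ultimately show False using pp by (auto simp: ping_pong_def)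
  qed
  then show ?thesis using w by (simp add: word_product_def)
qed

lemma ping_pong_free_product:
  assumes pp: "ping_pong I H X p" and H: "\<And>i. i \<in> I \<Longrightarrow> subgroup (H i) E"
    and S: "S = generate E (\<Union>i\<in>I. H i)"
  shows "is_free_product (E\<lparr>carrier := S\<rparr>) I H"
proof -
  have sub: "(\<Union>i\<in>I. H i) \<subseteq> carrier E" using H subgroup.subset by blast
  have S': "subgroup S E" unfolding S by (rule E.generate_is_subgroup[OF sub])
  have incl: "(\<Union>i\<in>I. H i) \<subseteq> S" unfolding S by (rule subsetI) (rule generate.incl)
  have "word_product (E\<lparr>carrier := S\<rparr>) w \<noteq> id" if w: "reduced_word (E\<lparr>carrier := S\<rparr>) I H w" "w \<noteq> []" for w
  proof
    assume id: "word_product (E\<lparr>carrier := S\<rparr>) w = id"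
    have w': "reduced_word E I H w" using w(1) by (simp add: reduced_word_def)
    have "word_product E w p = p" using id by (simp add: word_product_def)
    then have "p \<in> X (fst (hd w))" using ping_pong_word[OF pp w' w(2)] by simp
    moreover have "fst (hd w) \<in> I" by (rule reduced_word_hd[OF w' w(2)])
    ultimately show False using pp by (auto simp: ping_pong_def)
  qed
  moreover have "group (E\<lparr>carrier := S\<rparr>)" by (rule E.subgroup_imp_group[OF S'])
  moreover have "subgroup (H i) (E\<lparr>carrier := S\<rparr>)" if "i \<in> I" for i
    by (rule E.subgroup_incl[OF H[OF that] S']) (use incl that in blast)
  moreover have "generate (E\<lparr>carrier := S\<rparr>) (\<Union>i\<in>I. H i) = S"
    using E.generate_consistent[OF incl S'] S by (rule trans[OF _ sym])
  ultimately show ?thesis by (simp add: is_free_product_def)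
qed

section \<open>Changing the sign of a generator\<close>

text \<open>
  After composing with \<open>u\<close>, the repelling neighbourhood is the old one and the attracting
  neighbourhood is moved by \<open>u\<close>, into the domain \<open>X\<close> of \<open>u\<close>.
\<close>

lemma twist_attract:
  assumes s: "s \<in> carrier E" and u: "u \<in> carrier E" and A: "s ` (- B) \<subseteq> A"
    and u': "u ` (- X) \<subseteq> X" and X: "(A \<union> B) \<inter> X = {}"
  shows "(u \<circ> s) ` (- B) \<subseteq> u ` A" "u ` A \<inter> B = {}"
proof -
  show "(u \<circ> s) ` (- B) \<subseteq> u ` A" using A by fastforce
  have "u ` A \<subseteq> X" using u' X by blast
  then show "u ` A \<inter> B = {}" using X by blast
qed

text \<open>
  Replacing \<open>s i\<close> by \<open>s r \<circ> s i\<close> moves the attracting part \<open>A i\<close> of the domain of \<open>i\<close> by \<open>s r\<close>. The new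
  domain of \<open>r\<close> is the complement of a set \<open>D\<close>. This \<open>D\<close> lies in the set that one gets from the
  complement of the old domain of \<open>r\<close> by cutting out the parts \<open>A i\<close> and pasting in their images
  \<open>s r ` A i\<close>. As points only move within their orbits under \<open>s r\<close>, the translates of \<open>D\<close> are still
  disjoint.
\<close>

lemma ping_pong_twist:
  assumes pp: "ping_pong I (\<lambda>i. generate E {s i}) X p"
    and s: "\<And>i. i \<in> I \<Longrightarrow> s i \<in> carrier E"
    and r: "r \<in> I" "s r \<noteq> id" and T: "T \<subseteq> I - {r}"
    and XAB: "\<And>i. i \<in> T \<Longrightarrow> X i = A i \<union> B i" "\<And>i. i \<in> T \<Longrightarrow> A i \<inter> B i = {}"
    and att: "\<And>i. i \<in> T \<Longrightarrow> s i ` (- B i) \<subseteq> A i"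
  shows "\<exists>Y. ping_pong I (\<lambda>i. generate E {if i \<in> T then s r \<circ> s i else s i}) Y p"
proof -
  have pI: "p \<notin> X i" if "i \<in> I" for i using pp that by (auto simp: ping_pong_def)
  have dis: "X i \<inter> X j = {}" if "i \<in> I" "j \<in> I" "i \<noteq> j" for i j
    using pp that by (auto simp: ping_pong_def)
  have maps: "h ` (- X i) \<subseteq> X i" if "i \<in> I" "h \<in> generate E {s i}" "h \<noteq> id" for h i
    using pp that by (auto simp: ping_pong_def)
  have so: "s r \<in> generate E {s r}" by (simp add: generate.incl)
  have soX: "s r ` (- X r) \<subseteq> X r" using maps[OF r(1) so r(2)] .
  have injo: "inj (s r)" using inj_E s r by blast
  define Z where "Z i = (if i \<in> T then B i \<union> s r ` A i else X i)" for i
  define D where "D = insert p (\<Union>i\<in>I - {r}. Z i)"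
  define Y where "Y i = (if i = r then - D else Z i)" for i
  define V where "V = (\<Union>i\<in>T. A i)"
  have V: "V \<subseteq> - X r" using XAB T dis[of _ r] r(1) unfolding V_def by blast
  have AX: "A i \<subseteq> - X r" "B i \<subseteq> - X r" if "i \<in> T" for i using XAB[OF that] T that dis[of i r] r(1) by blast+
  have D: "(x \<in> - X r \<and> x \<notin> V) \<or> (\<exists>v\<in>V. x = s r v)" if "x \<in> D" for x
  proof -
    have ZX: "x \<in> X i" if "x \<in> Z i" "x \<notin> s r ` V" for i
      using that XAB by (auto simp: Z_def V_def split: if_splits)
    have "x \<notin> V" if "x \<in> Z i" "i \<in> I" "i \<noteq> r" "x \<notin> s r ` V" for i
    proof
      assume "x \<in> V"
      then obtain j where j: "j \<in> T" "x \<in> A j" by (auto simp: V_def)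
      have "x \<in> X i" using ZX that by blast
      moreover have "x \<in> X j" using j XAB by auto
      ultimately have "i = j" using dis[of i j] j T that by blast
      then have "x \<in> B j" using that j by (auto simp: Z_def V_def)
      then show False using XAB(2)[OF j(1)] j(2) by blast
    qed
    moreover have "x \<in> - X r" if "x \<in> Z i" "i \<in> I" "i \<noteq> r" "x \<notin> s r ` V" for i
      using ZX[of i] that dis[of i r] r(1) by blast
    moreover have "p \<notin> V" "p \<in> - X r" using pI XAB(1) T r(1) unfolding V_def by blast+
    ultimately show ?thesis using that unfolding D_def by blast
  qed
  have sub: "subgroup (generate E {s r}) E" using E.generate_is_subgroup s r by auto
  have free: "h = id" if "h \<in> generate E {s r}" "x \<in> - X r" "h x \<in> - X r" for h x
    using maps[OF r(1) that(1)] that by blast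
  \<comment> \<open>If \<open>D\<close> met its translate under \<open>h\<close>, undoing the pasting at \<open>x\<close> and at \<open>h x\<close> would give two
    points outside \<open>X r\<close> in one orbit. These coincide, so either both or none were pasted, and \<open>h\<close>
    is conjugate to the identity.\<close>
  have core: "h x \<notin> D" if h: "h \<in> generate E {s r}" "h \<noteq> id" and x: "x \<in> D" for h x
  proof
    assume hx: "h x \<in> D"
    have soE: "s r \<in> carrier E" using s r by blast
    have ic: "inv\<^bsub>E\<^esub> (s r) \<in> generate E {s r}" using so sub by (rule subgroup.m_inv_closed[rotated])
    have cl: "a \<circ> b \<in> generate E {s r}" if "a \<in> generate E {s r}" "b \<in> generate E {s r}" for a b
      using subgroup.m_closed[OF sub that] by simp
    from D[OF x] show False
    proof (elim disjE conjE bexE)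
      assume xU: "x \<in> - X r" "x \<notin> V"
      from D[OF hx] show False
      proof (elim disjE conjE bexE)
        assume "h x \<in> - X r"
        then show False using free[OF h(1) xU(1)] h by blast
      next
        fix v assume v: "v \<in> V" "h x = s r v"
        then have e: "(inv\<^bsub>E\<^esub> (s r) \<circ> h) x = v" using soE by simp
        have "inv\<^bsub>E\<^esub> (s r) \<circ> h = id" by (rule free[of _ x]) (use cl[OF ic h(1)] xU e v V in auto)
        then have "x = v" using e by simp
        then show False using v xU by simp
      qed
    next
      fix u assume u: "u \<in> V" "x = s r u"
      from D[OF hx] show False
      proof (elim disjE conjE bexE)
        assume hU: "h x \<in> - X r" "h x \<notin> V"
        have e: "(h \<circ> s r) u = h x" using u by simp
        have "h \<circ> s r = id" by (rule free[of _ u]) (use cl[OF h(1) so] hU e u V in auto)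
        then have "h x = u" using e by simp
        then show False using u hU by simp
      next
        fix v assume v: "v \<in> V" "h x = s r v"
        have e: "(inv\<^bsub>E\<^esub> (s r) \<circ> (h \<circ> s r)) u = v" using u v soE by simp
        have i: "inv\<^bsub>E\<^esub> (s r) \<circ> (h \<circ> s r) = id"
          by (rule free[of _ u]) (use cl[OF ic cl[OF h(1) so]] e u v V in auto)
        have "h z = z" for z
        proof -
          have "s r ((inv\<^bsub>E\<^esub> (s r)) (h (s r ((inv\<^bsub>E\<^esub> (s r)) z)))) = s r ((inv\<^bsub>E\<^esub> (s r)) z)"
            using fun_cong[OF i, of "(inv\<^bsub>E\<^esub> (s r)) z"] by simp
          then show ?thesis using soE by simp
        qed
        then show False using h by auto
      qed
    qed
  qed
  have soA: "s r ` A i \<subseteq> X r" if "i \<in> T" for i using AX[OF that] soX by blast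
  have Zdis: "Z i \<inter> Z j = {}" if ij: "i \<in> I - {r}" "j \<in> I - {r}" "i \<noteq> j" for i j
  proof -
    have c: "Z i \<subseteq> X i \<union> (if i \<in> T then s r ` A i else {})" for i
      using XAB by (auto simp: Z_def)
    have "X i \<inter> X j = {}" "X i \<inter> X r = {}" "X j \<inter> X r = {}" using dis ij r(1) by auto
    moreover have "s r ` A i \<inter> s r ` A j = {}" if "i \<in> T" "j \<in> T"
    proof -
      have "A i \<inter> A j = {}" using XAB(1)[OF that(1)] XAB(1)[OF that(2)] dis[of i j] ij by blast
      then show ?thesis using image_Int[OF injo, of "A i" "A j"] by simp
    qed
    ultimately show ?thesis using c[of i] c[of j] soA[of i] soA[of j]
      by (cases "i \<in> T"; cases "j \<in> T") (simp_all add: disjoint_iff subset_iff, blast+)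
  qed
  have pZ: "p \<notin> Z i" if "i \<in> I - {r}" for i
    using pI[of i] pI[of r] that XAB[of i] soA[of i] r(1) by (auto simp: Z_def)
  have "h ` (- Y i) \<subseteq> Y i"
    if i: "i \<in> I" and h: "h \<in> generate E {if i \<in> T then s r \<circ> s i else s i}" "h \<noteq> id" for i h
  proof (cases "i = r")
    case True
    then have "i \<notin> T" using T by blast
    then show ?thesis using h core True by (auto simp: Y_def)
  next
    case False
    show ?thesis
    proof (cases "i \<in> T")
      case True
      have "(A i \<union> B i) \<inter> X r = {}" using AX[OF True] by blast
      note ta = twist_attract[OF s[OF i] s[OF r(1)] att[OF True] soX this]
      have "h x \<in> s r ` A i \<union> B i" if "x \<notin> s r ` A i \<union> B i" for x
        by (rule generate_attract[OF _ ta _ h(2) that]) (use h True s i r in auto)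
      then show ?thesis using True False by (auto simp: Y_def Z_def)
    next
      case F: False
      then show ?thesis using maps[of i h] h i False by (auto simp: Y_def Z_def)
    qed
  qed
  moreover have "p \<notin> Y i" if "i \<in> I" for i using pZ[of i] that by (auto simp: Y_def D_def)
  moreover have "Y i \<inter> Y j = {}" if "i \<in> I" "j \<in> I" "i \<noteq> j" for i j
    using Zdis[of i j] that by (auto simp: Y_def D_def)
  ultimately have "ping_pong I (\<lambda>i. generate E {if i \<in> T then s r \<circ> s i else s i}) Y p"
    unfolding ping_pong_def by (intro conjI ballI impI allI) (blast+)
  then show ?thesis by blast
qed

section \<open>The factors\<close>

text \<open>
  The map \<open>place p\<close> carries the ray \<open>(-\<infinity>,0]\<close> to the piece number \<open>p\<close>: itself for \<open>p = 0\<close>, and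
  \<open>(i,i+1]\<close> for \<open>p = Suc i\<close>, where the map is \<open>z \<mapsto> i + 1/(1-z)\<close>.
\<close>

definition place :: "nat \<Rightarrow> qbar \<Rightarrow> qbar" where
  "place p = (case p of 0 \<Rightarrow> id | Suc i \<Rightarrow> moebius (- int i) (int i + 1) (- 1) 1)"

fun std :: "factor \<Rightarrow> qbar \<Rightarrow> qbar" where
  "std (Ord2 n) = moebius 0 (- 1) 1 0"
| "std (Ord3 n) = moebius 0 (- 1) 1 1"
| "std (InfCyc n) = moebius (- 1) (- 1) 1 2"

definition conj_at :: "nat \<Rightarrow> (qbar \<Rightarrow> qbar) \<Rightarrow> qbar \<Rightarrow> qbar" where
  "conj_at p e = place p \<circ> e \<circ> inv\<^bsub>E\<^esub> (place p)"

abbreviation left_ray :: "qbar set" where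
  "left_ray \<equiv> Some ` {..0}"

lemma place_in_E [simp]: "place p \<in> carrier E"
  by (cases p) (auto simp: place_def intro!: moebius_in_E)

lemma place_0 [simp]: "place 0 = id"
  by (simp add: place_def)

lemma place_Suc_None [simp]: "place (Suc i) None = Some (of_nat i)"
  by (simp add: place_def moebius_def)

lemma place_Suc_Some [simp]:
  "place (Suc i) (Some q) = (if q = 1 then None else Some (of_nat i + 1 / (1 - q)))"
  by (auto simp: place_def moebius_def field_simps)

lemma Some_in_image [simp]: "Some x \<in> Some ` A \<longleftrightarrow> x \<in> A"
  by auto

lemma place_left_ray_Suc: "place (Suc i) ` left_ray \<subseteq> Some ` {of_nat i<..of_nat i + 1}"
proof -
  have "0 < 1 / (1 - q)" "1 / (1 - q) \<le> 1" "q \<noteq> 1" if "q \<le> 0" for q :: rat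
    using that by auto
  then show ?thesis by auto
qed

lemma place_left_ray_disjoint:
  assumes "p \<noteq> q"
  shows "place p ` left_ray \<inter> place q ` left_ray = {}"
proof -
  have "place p ` left_ray \<inter> place q ` left_ray = {}" if pq: "p < q" for p q
  proof -
    obtain j where q: "q = Suc j" using pq by (cases q) auto
    have "place p ` left_ray \<subseteq> Some ` {..of_nat j}"
    proof (cases p)
      case (Suc i)
      then have "(of_nat i + 1 :: rat) \<le> of_nat j"
        using pq q by (metis Suc_leI Suc_less_eq of_nat_Suc of_nat_le_iff add.commute)
      then show ?thesis using place_left_ray_Suc[of i] Suc by fastforce
    qed auto
    then show ?thesis using place_left_ray_Suc[of j] q by fastforce
  qed
  then show ?thesis using assms by (metis inf_commute linorder_neqE_nat)
qed

lemma None_notin_place_left_ray: "None \<notin> place p ` left_ray"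
  by (cases p) (use place_left_ray_Suc in auto)

lemma std_in_E [simp]: "std f \<in> carrier E"
  by (cases f) (auto intro!: moebius_in_E)

lemma conj_at_in_E [simp]: "e \<in> carrier E \<Longrightarrow> conj_at p e \<in> carrier E"
  by (simp add: conj_at_def)

lemma conj_at_place [simp]: "conj_at p e (place p x) = place p (e x)"
  by (simp add: conj_at_def)

lemma conj_at_comp: "conj_at p e \<circ> conj_at p e' = conj_at p (e \<circ> e')"
  by (simp add: conj_at_def fun_eq_iff)

lemma conj_at_id [simp]: "conj_at p id = id"
  by (simp add: conj_at_def fun_eq_iff)

lemma conj_at_inject: "conj_at p e = conj_at p e' \<longleftrightarrow> e = e'"
proof
  assume eq: "conj_at p e = conj_at p e'"
  show "e = e'"
  proof
    fix x
    have "place p (e x) = place p (e' x)" using conj_at_place[of p] eq by metis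
    then show "e x = e' x" using inj_E[OF place_in_E] by (blast dest: injD)
  qed
qed simp

lemma conj_at_maps:
  assumes "\<And>x. x \<notin> X \<Longrightarrow> e x \<in> Y" "y \<notin> place p ` X"
  shows "conj_at p e y \<in> place p ` Y"
proof -
  have y: "y = place p ((inv\<^bsub>E\<^esub> (place p)) y)" by simp
  then have "(inv\<^bsub>E\<^esub> (place p)) y \<notin> X" using assms(2) by (metis imageI)
  then show ?thesis using assms(1) by (simp add: conj_at_def)
qed

lemma mdet_conj_at:
  assumes "e \<in> carrier E"
  shows "mdet (conj_at p e) = mdet e"
proof -
  have "mdet (place p) * mdet (inv\<^bsub>E\<^esub> (place p)) = 1"
    using mdet_comp[of "place p" "inv\<^bsub>E\<^esub> (place p)"] E.r_inv[OF place_in_E[of p]]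
    by (simp add: mdet_id)
  then show ?thesis using assms by (simp add: conj_at_def mdet_comp)
qed

lemma mdet_glide: "mdet (std (InfCyc n)) = - 1"
  by (simp add: mdet_moebius)

lemma moebius_minus_id: "moebius (- 1) 0 0 (- 1) = id"
  by (rule ext) (auto simp: moebius_def split: option.split)

lemma std_Ord2_square: "std (Ord2 n) \<circ> std (Ord2 n) = id"
  using moebius_comp[of 0 0 "- 1" 1 0 0 "- 1" 1] by (simp add: moebius_minus_id)

lemma std_Ord3_square: "std (Ord3 n) \<circ> std (Ord3 n) = moebius (- 1) (- 1) 1 0"
  using moebius_comp[of 0 1 "- 1" 1 0 1 "- 1" 1] by simp

lemma std_Ord3_cube: "std (Ord3 n) \<circ> (std (Ord3 n) \<circ> std (Ord3 n)) = id"
  unfolding std_Ord3_square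
  using moebius_comp[of 0 1 "- 1" 1 "- 1" 0 "- 1" 1] by (simp add: moebius_minus_id)

lemma generate_Ord2: "generate E {conj_at p (std (Ord2 n))} = {id, conj_at p (std (Ord2 n))}"
proof -
  have "conj_at p (std (Ord2 n)) \<otimes>\<^bsub>E\<^esub> conj_at p (std (Ord2 n)) = \<one>\<^bsub>E\<^esub>"
    unfolding E_mult conj_at_comp std_Ord2_square by simp
  from E.generate_involution[OF conj_at_in_E[OF std_in_E] this] show ?thesis
    unfolding E_one .
qed

lemma generate_Ord3:
  "generate E {conj_at p (std (Ord3 n))} =
     {id, conj_at p (std (Ord3 n)), conj_at p (std (Ord3 n) \<circ> std (Ord3 n))}"
proof -
  let ?x = "conj_at p (std (Ord3 n))"
  have x2: "?x \<circ> ?x = conj_at p (std (Ord3 n) \<circ> std (Ord3 n))" by (rule conj_at_comp)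
  have "?x \<otimes>\<^bsub>E\<^esub> (?x \<otimes>\<^bsub>E\<^esub> ?x) = \<one>\<^bsub>E\<^esub>"
    unfolding E_mult x2 conj_at_comp std_Ord3_cube by simp
  from E.generate_order_three[OF conj_at_in_E[OF std_in_E] this] show ?thesis
    unfolding E_mult E_one x2 .
qed

lemma card_generate_Ord2: "card (generate E {conj_at p (std (Ord2 n))}) = 2"
proof -
  have "std (Ord2 n) None \<noteq> id None" by (simp add: moebius_def)
  then have "conj_at p (std (Ord2 n)) \<noteq> id"
    using conj_at_inject[of p "std (Ord2 n)" id] unfolding conj_at_id by metis
  then show ?thesis unfolding generate_Ord2 by (simp add: card_insert_if del: std.simps)
qed

lemma card_generate_Ord3: "card (generate E {conj_at p (std (Ord3 n))}) = 3"
proof -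
  let ?b = "std (Ord3 n)"
  have "?b None \<noteq> id None" "(?b \<circ> ?b) None \<noteq> id None" "(?b \<circ> ?b) None \<noteq> ?b None"
    by (simp_all add: moebius_def)
  then have "?b \<noteq> id" "?b \<circ> ?b \<noteq> id" "?b \<circ> ?b \<noteq> ?b"
    by (auto simp: fun_eq_iff simp del: std.simps)
  then have "conj_at p ?b \<noteq> id" "conj_at p (?b \<circ> ?b) \<noteq> id" "conj_at p (?b \<circ> ?b) \<noteq> conj_at p ?b"
    using conj_at_inject[of p ?b id] conj_at_inject[of p "?b \<circ> ?b" id]
      conj_at_inject[of p "?b \<circ> ?b" ?b] unfolding conj_at_id by blast+
  then show ?thesis unfolding generate_Ord3 by (auto simp: card_insert_if simp del: std.simps)
qed

text \<open>
  The fixed points of \<open>-(z+1)/(z+2)\<close> are \<open>(-3 \<plusminus> \<surd>5)/2\<close>, one in \<open>(-1,0)\<close> and one below \<open>-1\<close>; hence the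
  ray is cut at \<open>-1\<close>.
\<close>

lemma glide_attract:
  "conj_at p (std (InfCyc n)) ` (- place p ` Some ` {..<- 1}) \<subseteq> place p ` Some ` {- 1..0}"
proof -
  have "std (InfCyc n) x \<in> Some ` {- 1..0}" if "x \<notin> Some ` {..<- 1}" for x
  proof (cases x)
    case None
    then show ?thesis by (simp add: moebius_def)
  next
    case (Some q)
    then have "q \<ge> - 1" using that by force
    then show ?thesis using Some by (auto simp: moebius_def field_simps)
  qed
  then show ?thesis by (intro image_subsetI) (rule conj_at_maps, auto)
qed

lemma left_ray_split:
  "place p ` left_ray = place p ` Some ` {- 1..0} \<union> place p ` Some ` {..<- 1}"
  "place p ` Some ` {- 1..0} \<inter> place p ` Some ` {..<- 1} = {}"
proof -
  have "{..0} = {- 1..0} \<union> {..<- 1 :: rat}" by auto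
  then have "left_ray = Some ` {- 1..0} \<union> Some ` {..<- 1}" by (metis image_Un)
  then show "place p ` left_ray = place p ` Some ` {- 1..0} \<union> place p ` Some ` {..<- 1}"
    by (simp add: image_Un)
  show "place p ` Some ` {- 1..0} \<inter> place p ` Some ` {..<- 1} = {}"
    using image_Int[OF inj_E[OF place_in_E[of p]], of "Some ` {- 1..0}" "Some ` {..<- 1}"] by fastforce
qed

lemma factor_ping_pong:
  assumes h: "h \<in> generate E {conj_at p (std f)}" "h \<noteq> id" and x: "x \<notin> place p ` left_ray"
  shows "h x \<in> place p ` left_ray"
proof (cases f)
  case (Ord2 n)
  have "std (Ord2 n) y \<in> left_ray" if "y \<notin> left_ray" for y
    using that by (cases y) (auto simp: moebius_def field_simps)
  then have "conj_at p (std (Ord2 n)) x \<in> place p ` left_ray" using x by (rule conj_at_maps)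
  then show ?thesis using h unfolding Ord2 generate_Ord2 by (auto simp del: std.simps)
next
  case (Ord3 n)
  have 1: "std (Ord3 n) y \<in> left_ray" if "y \<notin> left_ray" for y
    using that by (cases y) (auto simp: moebius_def field_simps)
  have 2: "(std (Ord3 n) \<circ> std (Ord3 n)) y \<in> left_ray" if "y \<notin> left_ray" for y
    unfolding std_Ord3_square
    using that by (cases y) (auto simp: moebius_def field_simps)
  have "conj_at p (std (Ord3 n)) x \<in> place p ` left_ray"
    using 1 x by (rule conj_at_maps)
  moreover have "conj_at p (std (Ord3 n) \<circ> std (Ord3 n)) x \<in> place p ` left_ray"
    using 2 x by (rule conj_at_maps)
  ultimately show ?thesis using h unfolding Ord3 generate_Ord3 by (auto simp del: std.simps)
next
  case (InfCyc n)
  have "h x \<in> place p ` Some ` {- 1..0} \<union> place p ` Some ` {..<- 1}"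
  proof (rule generate_attract[OF conj_at_in_E[OF std_in_E] glide_attract[of p n] left_ray_split(2) _ h(2)])
    show "h \<in> generate E {conj_at p (std (InfCyc n))}" using h(1) unfolding InfCyc .
    show "x \<notin> place p ` Some ` {- 1..0} \<union> place p ` Some ` {..<- 1}"
      using x unfolding left_ray_split(1) .
  qed
  then show ?thesis unfolding left_ray_split(1) .
qed

section \<open>Transitivity\<close>

text \<open>
  Some power of each building block has the form \<open>-1/(z+c)\<close>, with \<open>c = 0\<close>, \<open>c = 1\<close> and \<open>c = 3\<close>
  respectively (for the glide reflection it is the square). It sends \<open>-n\<close> to \<open>1/(n-c)\<close>. The remaining
  points \<open>-n\<close>, \<open>0 \<le> n \<le> c\<close>, are in the orbit of \<open>\<infinity>\<close>; under the glide reflection this orbit contains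
  \<open>-3 \<mapsto> -2 \<mapsto> \<infinity> \<mapsto> -1 \<mapsto> 0\<close>.
\<close>

lemma std_orbit:
  assumes Q: "\<And>x. std f x \<in> Q \<longleftrightarrow> x \<in> Q"
  shows "\<exists>c::nat. \<forall>n. (n \<le> c \<longrightarrow> None \<in> Q \<longrightarrow> Some (- of_nat n) \<in> Q) \<and>
    (c < n \<longrightarrow> Some (1 / of_nat (n - c)) \<in> Q \<longrightarrow> Some (- of_nat n) \<in> Q)"
proof (cases f)
  case (Ord2 k)
  have "None \<in> Q \<longleftrightarrow> Some 0 \<in> Q" using Q[of "Some 0"] Ord2 by (simp add: moebius_def)
  moreover have "Some (1 / of_nat n) \<in> Q \<longleftrightarrow> Some (- of_nat n) \<in> Q" if "n > 0" for n
    using Q[of "Some (- of_nat n)"] Ord2 that by (simp add: moebius_def)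
  ultimately show ?thesis by (intro exI[of _ 0]) auto
next
  case (Ord3 k)
  have 1: "None \<in> Q \<longleftrightarrow> Some (- 1) \<in> Q" using Q[of "Some (- 1)"] Ord3 by (simp add: moebius_def)
  have 0: "Some (- 1) \<in> Q \<longleftrightarrow> Some 0 \<in> Q" using Q[of "Some 0"] Ord3 by (simp add: moebius_def)
  have n: "Some (1 / of_nat (n - 1)) \<in> Q \<longleftrightarrow> Some (- of_nat n) \<in> Q" if "n > 1" for n
  proof -
    have "- 1 / (- of_nat n + 1) = (1 / of_nat (n - 1) :: rat)" "- of_nat n + 1 \<noteq> (0 :: rat)"
      using that by (auto simp: of_nat_diff field_simps)
    then show ?thesis using Q[of "Some (- of_nat n)"] Ord3 by (simp add: moebius_def)
  qed
  show ?thesis using 0 1 n by (intro exI[of _ 1]) (auto simp: le_Suc_eq)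
next
  case (InfCyc k)
  have 1: "None \<in> Q \<longleftrightarrow> Some (- 1) \<in> Q" using Q[of None] InfCyc by (simp add: moebius_def)
  have 0: "Some (- 1) \<in> Q \<longleftrightarrow> Some 0 \<in> Q" using Q[of "Some (- 1)"] InfCyc by (simp add: moebius_def)
  have 2: "None \<in> Q \<longleftrightarrow> Some (- 2) \<in> Q" using Q[of "Some (- 2)"] InfCyc by (simp add: moebius_def)
  have 3: "Some (- 2) \<in> Q \<longleftrightarrow> Some (- 3) \<in> Q" using Q[of "Some (- 3)"] InfCyc by (simp add: moebius_def)
  have n: "Some (1 / of_nat (n - 3)) \<in> Q \<longleftrightarrow> Some (- of_nat n) \<in> Q" if "n > 3" for n
  proof -
    have n: "of_nat n > (3 :: rat)" using that by (metis of_nat_less_iff of_nat_numeral)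
    have sq: "std f \<circ> std f = moebius 0 (- 1) 1 3"
      using moebius_comp[of "- 1" 2 "- 1" 1 "- 1" 2 "- 1" 1] InfCyc by simp
    have "- 1 / (- of_nat n + 3) = (1 / of_nat (n - 3) :: rat)" "- of_nat n + 3 \<noteq> (0 :: rat)"
      using n that by (auto simp: of_nat_diff field_simps)
    then have "std f (std f (Some (- of_nat n))) = Some (1 / of_nat (n - 3))"
      using fun_cong[OF sq, of "Some (- of_nat n)"] by (simp add: moebius_def)
    then show ?thesis using Q by metis
  qed
  have "n \<le> 3 \<Longrightarrow> None \<in> Q \<Longrightarrow> Some (- of_nat n) \<in> Q" for n :: nat
    using 0 1 2 3 by (auto simp: le_Suc_eq numeral_eq_Suc)
  then show ?thesis using n by (intro exI[of _ 3]) auto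
qed

text \<open>
  In the piece \<open>(i,i+1]\<close> the coordinates \<open>\<infinity>\<close>, \<open>0\<close> and \<open>-n\<close> stand for \<open>i\<close>, \<open>i+1\<close> and \<open>i + 1/(n+1)\<close>, and
  the coordinate \<open>1/m\<close> stands for \<open>i+1 + 1/(m-1)\<close>, a point of the next piece (of \<open>\<infinity>\<close> if \<open>m = 1\<close>). So a
  point \<open>i + 1/(n+1)\<close> is in the orbit of an integer, of \<open>\<infinity>\<close>, or of a point of the same form in the
  next piece with smaller \<open>n\<close>. The block in the ray carries a negative integer to \<open>\<infinity>\<close> or
  to such a point.
\<close>

lemma integers_in_orbit:
  assumes None: "None \<in> Q" and Q: "\<And>p. \<exists>f. \<forall>x. place p (std f x) \<in> Q \<longleftrightarrow> place p x \<in> Q"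
  shows "Some (of_int k) \<in> Q"
proof -
  have orb: "\<exists>c::nat. \<forall>n. (n \<le> c \<longrightarrow> place p None \<in> Q \<longrightarrow> place p (Some (- of_nat n)) \<in> Q) \<and>
    (c < n \<longrightarrow> place p (Some (1 / of_nat (n - c))) \<in> Q \<longrightarrow> place p (Some (- of_nat n)) \<in> Q)" for p
  proof -
    obtain f where f: "\<forall>x. place p (std f x) \<in> Q \<longleftrightarrow> place p x \<in> Q" using Q by blast
    show ?thesis using std_orbit[of f "{x. place p x \<in> Q}"] f by simp
  qed
  have nat: "Some (of_nat i) \<in> Q" for i
  proof (induction i)
    case 0
    then show ?case using orb[of 0] None by auto
  next
    case (Suc i)
    then show ?case using orb[of "Suc i"] by (force simp: add.commute)
  qed
  have unit: "Some (of_nat i + 1 / of_nat (Suc n)) \<in> Q" for n i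
  proof (induction n arbitrary: i rule: less_induct)
    case (less n)
    obtain c :: nat where
      c1: "\<And>n. n \<le> c \<Longrightarrow> place (Suc i) None \<in> Q \<Longrightarrow> place (Suc i) (Some (- of_nat n)) \<in> Q" and
      c2: "\<And>n. c < n \<Longrightarrow> place (Suc i) (Some (1 / of_nat (n - c))) \<in> Q \<Longrightarrow>
        place (Suc i) (Some (- of_nat n)) \<in> Q"
      using orb[of "Suc i"] by blast
    have pl: "place (Suc i) (Some (- of_nat n)) = Some (of_nat i + 1 / of_nat (Suc n))"
      by auto
    have "place (Suc i) (Some (1 / of_nat (n - c))) \<in> Q" if "c < n"
    proof (cases "n - c = 1")
      case True
      then show ?thesis using None by simp
    next
      case False
      define m where "m = n - c - 2"
      have m: "n - c = Suc (Suc m)" "m < n" using False that by (auto simp: m_def)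
      have "1 / (1 - 1 / of_nat (Suc (Suc m))) = 1 + 1 / (of_nat (Suc m) :: rat)"
        by (simp add: field_simps)
      then have "place (Suc i) (Some (1 / of_nat (n - c))) = Some (of_nat (Suc i) + 1 / of_nat (Suc m))"
        unfolding m(1) by (simp add: add.assoc)
      then show ?thesis using less[OF m(2), of "Suc i"] by simp
    qed
    then show ?case using c1[of n] c2[of n] nat[of i] pl by (cases "n \<le> c") auto
  qed
  have neg: "Some (- of_nat n) \<in> Q" for n
  proof -
    obtain c :: nat where c: "n \<le> c \<Longrightarrow> None \<in> Q \<Longrightarrow> Some (- of_nat n) \<in> Q"
      "c < n \<Longrightarrow> Some (1 / of_nat (n - c)) \<in> Q \<Longrightarrow> Some (- of_nat n) \<in> Q"
      using orb[of 0] by auto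
    show ?thesis
    proof (cases "n \<le> c")
      case False
      then show ?thesis using c unit[of 0 "n - c - 1"] by (simp add: Suc_diff_Suc)
    qed (use c None in simp)
  qed
  show ?thesis using nat neg by (cases k rule: int_cases2) auto
qed

text \<open>
  The Euclidean algorithm. A map in the group that sends \<open>\<infinity>\<close> to an integer \<open>n\<close> is \<open>(a z+b)/(c z+d)\<close>
  with \<open>c = \<plusminus>1\<close> and \<open>a = c n\<close>, so its inverse sends \<open>p/q\<close> to a fraction with denominator \<open>p - n q\<close>,
  up to sign. With \<open>n = p div q\<close> this is less than \<open>q\<close>.
\<close>

lemma transitive_if_integers:
  assumes S: "subgroup S E" and int: "\<And>k. \<exists>\<alpha>\<in>S. \<alpha> None = Some (of_int k)"
  shows "\<exists>\<alpha>\<in>S. \<alpha> None = r"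
proof -
  have frac: "\<exists>\<alpha>\<in>S. \<alpha> None = Some (of_int p / of_nat q)" if "q > 0" for p q
    using that
  proof (induction q arbitrary: p rule: less_induct)
    case (less q)
    define n m where "n = p div int q" and "m = p mod int q"
    have p: "p = n * int q + m" by (simp add: n_def m_def)
    have m: "0 \<le> m" "m < int q" using less.prems by (auto simp: m_def)
    obtain \<alpha> where \<alpha>: "\<alpha> \<in> S" "\<alpha> None = Some (of_int n)" using int by blast
    show ?case
    proof (cases "m = 0")
      case True
      then have "of_int p / of_nat q = (of_int n :: rat)" using less.prems p by simp
      then show ?thesis using \<alpha> by auto
    next
      case False
      have \<alpha>E: "\<alpha> \<in> carrier E" using \<alpha> S by (meson subgroup.mem_carrier)
      then obtain a b c d where abcd: "\<alpha> = moebius a b c d" "a * d - b * c \<in> {1, -1}"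
        by (rule E_moebiusE)
      have c0: "c \<noteq> 0" and "of_int a / of_int c = (of_int n :: rat)"
        using \<alpha>(2) abcd(1) by (auto simp: moebius_def split: if_splits)
      then have "of_int a = (of_int (n * c) :: rat)" by (simp add: field_simps)
      then have a: "a = n * c" using of_int_eq_iff by blast
      have "c * (n * d - b) \<in> {1, -1}" using abcd(2) a by (simp add: algebra_simps)
      then have c: "c = 1 \<or> c = - 1" by (auto simp: zmult_eq_1_iff) (metis minus_mult_right zmult_eq_1_iff minus_equation_iff)
      define m' where "m' = nat m"
      have m': "0 < m'" "m' < q" "m = int m'" using m False by (auto simp: m'_def)
      have "moebius d (- b) (- c) a (Some (of_int p / of_nat q)) = Some (of_int (- c * (d * p - b * int q)) / of_nat m')"
      proof -
        have q0: "(of_nat q :: rat) \<noteq> 0" using less.prems by simp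
        have den: "of_int (- c) * (of_int p / of_nat q) + of_int a = (- of_int (c * int m') / of_nat q :: rat)"
          using q0 by (simp add: p a m'(3) field_simps)
        have num: "of_int d * (of_int p / of_nat q) + of_int (- b) = (of_int (d * p - b * int q) / of_nat q :: rat)"
          using q0 by (simp add: field_simps)
        have "- of_int (c * int m') / of_nat q \<noteq> (0 :: rat)" using c0 m' q0 by simp
        then show ?thesis
          unfolding moebius_def option.case den num using c m' q0 by (auto simp: field_simps)
      qed
      note val = this
      obtain \<beta> where \<beta>: "\<beta> \<in> S" "\<beta> None = Some (of_int (- c * (d * p - b * int q)) / of_nat m')"
        using less.IH[OF m'(2,1)] by blast
      have "moebius a b c d (moebius d (- b) (- c) a z) = z" for z
      proof -
        have i: "moebius d (- b) (- c) a = inv\<^bsub>E\<^esub> \<alpha>"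
          using moebius_left_inverse[OF abcd(2)] abcd \<alpha>E
          by (intro E.inv_equality[symmetric]) (auto intro!: moebius_in_E simp: algebra_simps)
        show ?thesis unfolding i abcd(1)[symmetric] using \<alpha>E by simp
      qed
      then have "(\<alpha> \<circ> \<beta>) None = Some (of_int p / of_nat q)"
        using \<beta>(2) val abcd(1) by (metis comp_apply)
      moreover have "\<alpha> \<circ> \<beta> \<in> S" using subgroup.m_closed[OF S \<alpha>(1) \<beta>(1)] by simp
      ultimately show ?thesis by blast
    qed
  qed
  show ?thesis
  proof (cases r)
    case None
    then show ?thesis using subgroup.one_closed[OF S] by (intro bexI[of _ id]) auto
  next
    case (Some x)
    obtain p q where "x = of_int p / of_int q" "q > 0" by (metis quotient_of_div quotient_of_denom_pos surj_pair)
    then show ?thesis using frac[of "nat q" p] Some by simp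
  qed
qed

section \<open>The Neumann subgroup\<close>

lemma sign_choice:
  fixes rm rp :: enat
  assumes "rm \<ge> 1"
  obtains T where "0 \<notin> T" "T \<subseteq> {n. enat n < rm + rp}" "ecard T = rp"
    "ecard ({n. enat n < rm + rp} - T) = rm"
proof (cases rm)
  case (enat k)
  define T where "T = {n. k \<le> n \<and> enat n < rm + rp}"
  have k: "k > 0" using assms enat by (simp add: one_enat_def)
  have "{n. enat n < rm + rp} - T = {..<k}"
    using enat by (cases rp) (auto simp: T_def)
  moreover have "ecard T = rp"
  proof (cases rp)
    case (enat l)
    then have "T = {k..<k + l}" using \<open>rm = enat k\<close> by (auto simp: T_def)
    then show ?thesis using enat by (simp add: ecard_def)
  next
    case infinity
    then have "T = {k..}" by (auto simp: T_def)
    then show ?thesis using infinity by (simp add: ecard_def infinite_Ici)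
  qed
  ultimately show ?thesis using that[of T] k enat by (auto simp: T_def ecard_def)
next
  case infinity
  show ?thesis
  proof (cases rp)
    case (enat l)
    have "infinite (UNIV - {1..l})" by simp
    then show ?thesis using that[of "{1..l}"] enat infinity by (simp add: ecard_def)
  next
    case inf: infinity
    have o: "infinite {n::nat. odd n}" and e: "infinite {n::nat. even n}"
      by (auto simp: infinite_nat_iff_unbounded) (metis even_Suc lessI less_SucI)+
    have "UNIV - {n::nat. odd n} = {n. even n}" by auto
    then show ?thesis using that[of "{n. odd n}"] o e inf infinity by (simp add: ecard_def)
  qed
qed

lemma infinite_factors:
  assumes "r2 + r3 + ri = \<infinity>"
  shows "infinite (factors r2 r3 ri)"
proof -
  have fin: "finite {n. enat n < r} \<Longrightarrow> r \<noteq> \<infinity>" for r by (cases r) auto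
  show ?thesis
  proof
    assume "finite (factors r2 r3 ri)"
    then have "finite (Ord2 ` {n. enat n < r2})" "finite (Ord3 ` {n. enat n < r3})"
      "finite (InfCyc ` {n. enat n < ri})" by (simp_all add: factors_def)
    then have "r2 \<noteq> \<infinity>" "r3 \<noteq> \<infinity>" "ri \<noteq> \<infinity>"
      using fin by (auto dest!: finite_imageD simp: inj_on_def)
    then show False using assms by (auto simp: plus_eq_infty_iff_enat)
  qed
qed

lemma countable_factors: "countable (factors r2 r3 ri)"
  by (simp add: factors_def)

theorem theorem3p3:
  fixes r2 r3 rm rp :: enat
  assumes "rp \<in> insert \<infinity> {enat (2 * k) | k. True}"
    and "r2 + r3 + rm + rp = \<infinity>"
    and "rm \<ge> 1"
    and "r2 + r3 + ehalf rp \<ge> rm"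
  shows "\<exists>S. neumann_subgroup S \<and> S - modular_maps \<noteq> {} \<and>
    (\<exists>H t. structure_decomposition (ext_modular_group\<lparr>carrier := S\<rparr>) r2 r3 (rm + rp) H t \<and>
       ecard {n. enat n < rm + rp \<and> mdet (t n) = -1} = rm \<and>
       ecard {n. enat n < rm + rp \<and> mdet (t n) = 1} = rp)"
proof -
  \<comment> \<open>\<open>P\<close> numbers the generators that shall have determinant \<open>1\<close>; \<open>0\<close> is left out because the
    generator with that number does the twisting.\<close>
  obtain P where P: "0 \<notin> P" "P \<subseteq> {n. enat n < rm + rp}" "ecard P = rp"
    "ecard ({n. enat n < rm + rp} - P) = rm"
    using sign_choice[OF assms(3)] by blast
  define I where "I = factors r2 r3 (rm + rp)"
  have "infinite I" unfolding I_def using assms(2) by (intro infinite_factors) (simp add: add.assoc)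
  then have bij: "bij_betw (to_nat_on I) I UNIV"
    by (rule to_nat_on_infinite[rotated]) (simp add: I_def countable_factors)
  define pos where "pos = to_nat_on I"
  have inj: "pos i \<noteq> pos j" if "i \<in> I" "j \<in> I" "i \<noteq> j" for i j
    using bij that by (auto simp: bij_betw_def pos_def dest: inj_onD)
  have surj: "\<exists>f\<in>I. pos f = p" for p
    using bij by (auto simp: bij_betw_def pos_def image_iff) (metis UNIV_I imageE)
  define s where "s f = conj_at (pos f) (std f)" for f
  have sE: "s f \<in> carrier E" for f by (simp add: s_def del: std.simps)
  define r where "r = InfCyc 0"
  have "1 \<le> rm + rp" using assms(3) by (simp add: add_increasing2)
  then have "0 < rm + rp" by (rule order.strict_trans2[OF zero_less_one])
  then have rI: "r \<in> I" by (auto simp: r_def I_def factors_def zero_enat_def)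
  define T where "T = InfCyc ` P"
  have TI: "T \<subseteq> I - {r}" using P by (auto simp: T_def r_def I_def factors_def)
  define u where "u f = (if f \<in> T then s r \<circ> s f else s f)" for f
  have uE: "u f \<in> carrier E" for f using sE by (simp add: u_def)
  have mdet_s: "mdet (s (InfCyc n)) = - 1" for n
    unfolding s_def by (simp add: mdet_conj_at mdet_glide del: std.simps)
  have sr: "s r \<noteq> id" using mdet_s[of 0] mdet_id by (auto simp: r_def)
  have pp: "ping_pong I (\<lambda>f. generate E {s f}) (\<lambda>f. place (pos f) ` left_ray) None"
    unfolding ping_pong_def
    using None_notin_place_left_ray place_left_ray_disjoint[OF inj] factor_ping_pong
    by (auto simp: s_def simp del: std.simps)
  have glide: "s f ` (- place (pos f) ` Some ` {..<- 1}) \<subseteq> place (pos f) ` Some ` {- 1..0}"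
    if "f \<in> range InfCyc" for f
    using that glide_attract unfolding s_def by blast
  have "\<exists>Y. ping_pong I (\<lambda>f. generate E {if f \<in> T then s r \<circ> s f else s f}) Y None"
    by (rule ping_pong_twist[OF pp sE rI sr TI left_ray_split], rule glide) (auto simp: T_def)
  then obtain Y where Y: "ping_pong I (\<lambda>f. generate E {u f}) Y None" by (auto simp: u_def)
  define H where "H f = generate E {u f}" for f
  have H: "subgroup (H f) E" for f unfolding H_def using uE by (intro E.generate_is_subgroup) simp
  define S where "S = generate E (\<Union>f\<in>I. H f)"
  have pH: "ping_pong I H Y None" using Y unfolding H_def[abs_def] .
  have S: "subgroup S E"
    unfolding S_def using H subgroup.subset by (intro E.generate_is_subgroup) blast
  have uS: "u f \<in> S" if "f \<in> I" for f
    unfolding S_def H_def by (intro generate.incl UN_I[OF that]) simp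
  have rT: "r \<notin> T" using TI by blast
  have srS: "s r \<in> S" using uS[OF rI] rT by (simp add: u_def)
  \<comment> \<open>The twisted generators generate the same group, so the orbits can be computed with the
    untwisted ones.\<close>
  have sS: "s f \<in> S" if "f \<in> I" for f
  proof (cases "f \<in> T")
    case True
    have "inv\<^bsub>E\<^esub> (s r) \<otimes>\<^bsub>E\<^esub> u f \<in> S"
      using subgroup.m_closed[OF S subgroup.m_inv_closed[OF S srS] uS[OF that]] .
    moreover have "inv\<^bsub>E\<^esub> (s r) \<otimes>\<^bsub>E\<^esub> u f = s f"
      using True sE by (simp add: u_def fun_eq_iff)
    ultimately show ?thesis by simp
  qed (use uS[OF that] in \<open>simp add: u_def\<close>)
  define Q where "Q = {x. \<exists>\<alpha>\<in>S. \<alpha> None = x}"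
  have Qcl: "h x \<in> Q" if h: "h \<in> S" and x: "x \<in> Q" for h x
  proof -
    obtain \<alpha> where \<alpha>: "\<alpha> \<in> S" "\<alpha> None = x" using x by (auto simp: Q_def)
    then show ?thesis using subgroup.m_closed[OF S h \<alpha>(1)]
      by (auto simp: Q_def intro!: bexI[of _ "h \<circ> \<alpha>"])
  qed
  have "Some (of_int k) \<in> Q" for k
  proof (rule integers_in_orbit)
    show "None \<in> Q" using subgroup.one_closed[OF S] by (auto simp: Q_def intro!: bexI[of _ id])
    fix p
    obtain f where f: "f \<in> I" "pos f = p" using surj by blast
    have c: "s f (place p x) = place p (std f x)" for x
      unfolding s_def f(2) by (rule conj_at_place)
    have "place p (std f x) \<in> Q \<longleftrightarrow> place p x \<in> Q" for x
      using Qcl[OF sS[OF f(1)], of "place p x"]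
        Qcl[OF subgroup.m_inv_closed[OF S sS[OF f(1)]], of "s f (place p x)"] sE
      unfolding c[symmetric] by auto
    then show "\<exists>f. \<forall>x. place p (std f x) \<in> Q \<longleftrightarrow> place p x \<in> Q" by blast
  qed
  then have "\<exists>\<alpha>\<in>S. \<alpha> None = Some (of_int k)" for k by (simp add: Q_def)
  then have trans: "\<exists>\<alpha>\<in>S. \<alpha> None = x" for x by (rule transitive_if_integers[OF S])
  have "neumann_subgroup S"
    unfolding neumann_subgroup_def
  proof (rule conjI[OF S], rule allI)
    fix x
    have "\<alpha> = \<beta>" if ab: "\<alpha> \<in> S" "\<alpha> None = x" "\<beta> \<in> S" "\<beta> None = x" for \<alpha> \<beta>
    proof -
      have E: "\<alpha> \<in> carrier E" "\<beta> \<in> carrier E"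
        using subgroup.mem_carrier[OF S] ab by auto
      have "inv\<^bsub>E\<^esub> \<beta> \<circ> \<alpha> \<in> S"
        using subgroup.m_closed[OF S subgroup.m_inv_closed[OF S ab(3)] ab(1)] by simp
      moreover have "(inv\<^bsub>E\<^esub> \<beta> \<circ> \<alpha>) None = None"
        using inv_E_apply(1)[OF E(2), of None] ab by simp
      ultimately have i: "inv\<^bsub>E\<^esub> \<beta> \<circ> \<alpha> = id"
        unfolding S_def by (rule ping_pong_free[OF pH H])
      show ?thesis
      proof
        fix z
        have "\<beta> ((inv\<^bsub>E\<^esub> \<beta>) (\<alpha> z)) = \<beta> z" using fun_cong[OF i, of z] by simp
        then show "\<alpha> z = \<beta> z" using E by simp
      qed
    qed
    then show "\<exists>!\<alpha>. \<alpha> \<in> S \<and> \<alpha> None = x" using trans[of x] by blast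
  qed
  moreover have "S - modular_maps \<noteq> {}"
    using srS mdet_s[of 0] by (auto simp: modular_maps_def r_def)
  moreover have "structure_decomposition (E\<lparr>carrier := S\<rparr>) r2 r3 (rm + rp) H (\<lambda>n. u (InfCyc n))"
    unfolding structure_decomposition_def
  proof (intro conjI allI impI)
    show "is_free_product (E\<lparr>carrier := S\<rparr>) (factors r2 r3 (rm + rp)) H"
      using ping_pong_free_product[OF pH H S_def] unfolding I_def .
    fix n
    show "card (H (Ord2 n)) = 2" "card (H (Ord3 n)) = 3"
      using card_generate_Ord2 card_generate_Ord3
      by (auto simp: H_def u_def T_def s_def simp del: std.simps)
    assume "enat n < rm + rp"
    then have nI: "InfCyc n \<in> I" by (simp add: I_def factors_def)
    then show uC: "u (InfCyc n) \<in> carrier (E\<lparr>carrier := S\<rparr>)" using uS by simp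
    show "H (InfCyc n) = generate (E\<lparr>carrier := S\<rparr>) {u (InfCyc n)}"
      unfolding H_def using uS[OF nI] by (intro E.generate_consistent[symmetric] S) simp
    let ?f = "InfCyc n"
    let ?A = "place (pos ?f) ` Some ` {- 1..0}" and ?B = "place (pos ?f) ` Some ` {..<- 1}"
    note AB = left_ray_split[of "pos ?f"]
    have None_AB: "None \<notin> ?A \<union> ?B"
      using None_notin_place_left_ray[of "pos ?f"] unfolding AB(1) .
    show "infinite (H ?f)"
    proof (cases "?f \<in> T")
      case True
      then have "?f \<noteq> r" using TI by blast
      have X: "(?A \<union> ?B) \<inter> place (pos r) ` left_ray = {}"
        unfolding AB(1)[symmetric] using place_left_ray_disjoint[OF inj[OF nI rI \<open>?f \<noteq> r\<close>]] .
      have sX: "s r ` (- place (pos r) ` left_ray) \<subseteq> place (pos r) ` left_ray"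
      proof -
        have "s r \<in> generate E {s r}" by (intro generate.incl) simp
        then show ?thesis using pp rI sr unfolding ping_pong_def by blast
      qed
      note ta = twist_attract[OF sE sE glide[OF rangeI] sX X]
      have "?A \<subseteq> - place (pos r) ` left_ray" using X by blast
      then have "s r ` ?A \<subseteq> place (pos r) ` left_ray" using sX by (meson image_mono subset_trans)
      then have "None \<notin> s r ` ?A" using None_notin_place_left_ray by (rule contra_subsetD)
      then have "None \<notin> s r ` ?A \<union> ?B" using None_AB by simp
      then have "infinite (generate E {s r \<circ> s ?f})"
        by (rule infinite_generate_attract[OF comp_in_E[OF sE sE] ta])
      then show ?thesis using True by (simp add: H_def u_def)
    next
      case False
      have "infinite (generate E {s ?f})"
        using None_AB by (rule infinite_generate_attract[OF sE glide[OF rangeI] AB(2)])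
      then show ?thesis using False by (simp add: H_def u_def)
    qed
  qed
  moreover have "ecard {n. enat n < rm + rp \<and> mdet (u (InfCyc n)) = - 1} = rm"
    "ecard {n. enat n < rm + rp \<and> mdet (u (InfCyc n)) = 1} = rp"
  proof -
    have mdet_u: "mdet (u (InfCyc n)) = (if n \<in> P then 1 else - 1)" for n
    proof -
      have "InfCyc n \<in> T \<longleftrightarrow> n \<in> P" by (auto simp: T_def)
      then show ?thesis using mdet_s mdet_comp[OF sE sE] by (simp add: u_def r_def)
    qed
    have "{n. enat n < rm + rp \<and> mdet (u (InfCyc n)) = - 1} = {n. enat n < rm + rp} - P"
      "{n. enat n < rm + rp \<and> mdet (u (InfCyc n)) = 1} = P"
      using P(2) by (auto simp: mdet_u)
    then show "ecard {n. enat n < rm + rp \<and> mdet (u (InfCyc n)) = - 1} = rm"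
      "ecard {n. enat n < rm + rp \<and> mdet (u (InfCyc n)) = 1} = rp"
      using P(3,4) by simp_all
  qed
  ultimately show ?thesis by blast
qed

end
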